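(* The ideal $\mathcal R$ on $\omega$ generated by the homogeneous sets in some fixed instance of the random graph on $\omega$ is not $\le_K$-homogeneous (in particular, it is not homogeneous).
   Context: An ideal on a set $X$ is a family of subsets of $X$ closed under finite unions and subsets, containing all finite subsets of $X$ and not containing $X$; $\mathcal I^+=\mathcal P(X)\setminus\mathcal I$. The random graph on $\omega$ is the (unique up to isomorphism) countable graph with vertex set $\omega$ such that for any two disjoint finite sets $U,V\subseteq\omega$ there is a vertex outside $U\cup V$ adjacent to all vertices of $U$ and to none of $V$. A set of vertices is homogeneous (in the graph) if it is a clique or an independent set. $\mathcal R$ consists of all subsets of finite unions of homogeneous sets. For ideals $\mathcal I$ on $X$ and $\mathcal K$ on $Y$, $\mathcal I\le_K\mathcal K$ (Katětov order) means that there is $f:Y\to X$ with $f^{-1}[B]\in\mathcal K$ for all $B\in\mathcal I$; $\mathcal I$ and $\mathcal K$ are isomorphic if there is a bijection $f:Y\to X$ with $f^{-1}[B]\in\mathcal K\iff B\in\mathcal I$. For $A\in\mathcal I^+$, $\mathcal I\restriction A=\{B\cap A:B\in\mathcal I\}$ (an ideal on $A$). An ideal $\mathcal I$ is homogeneous if $\mathcal I\restriction A$ is isomorphic to $\mathcal I$ for each $A\in\mathcal I^+$, and $\le_K$-homogeneous if $\mathcal I\restriction A\le_K\mathcal I$ and $\mathcal I\le_K\mathcal I\restriction A$ for each $A\in\mathcal I^+$. *)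

theory Defs
  imports "HOL-Library.Ramsey" "HOL-Library.FuncSet"
begin

definition is_ideal :: "'a set \<Rightarrow> 'a set set \<Rightarrow> bool" where
  "is_ideal X I \<longleftrightarrow>
     I \<subseteq> Pow X \<and>
     (\<forall>A\<in>I. \<forall>B\<in>I. A \<union> B \<in> I) \<and>
     (\<forall>A\<in>I. \<forall>B. B \<subseteq> A \<longrightarrow> B \<in> I) \<and>
     (\<forall>F. F \<subseteq> X \<and> finite F \<longrightarrow> F \<in> I) \<and>
     X \<notin> I"

definition positive_sets :: "'a set \<Rightarrow> 'a set set \<Rightarrow> 'a set set" where
  "positive_sets X I = Pow X - I"

definition ideal_restrict :: "'a set set \<Rightarrow> 'a set \<Rightarrow> 'a set set" where
  "ideal_restrict I A = {B \<inter> A |B. B \<in> I}"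

text \<open>The underlying set precedes each ideal, since it cannot in general be read off the type.
  The smaller side comes first: \<open>katetov_le X I Y K\<close> is I \<open>\<le>\<^sub>K\<close> K, so the witness
  maps Y to X.\<close>

definition katetov_le :: "'a set \<Rightarrow> 'a set set \<Rightarrow> 'b set \<Rightarrow> 'b set set \<Rightarrow> bool" where
  "katetov_le X I Y K \<longleftrightarrow> (\<exists>f \<in> Y \<rightarrow> X. \<forall>B\<in>I. f -` B \<inter> Y \<in> K)"

definition ideal_isomorphic :: "'a set \<Rightarrow> 'a set set \<Rightarrow> 'b set \<Rightarrow> 'b set set \<Rightarrow> bool" where
  "ideal_isomorphic X I Y K \<longleftrightarrow>
     (\<exists>f. bij_betw f Y X \<and> (\<forall>B. B \<subseteq> X \<longrightarrow> (f -` B \<inter> Y \<in> K \<longleftrightarrow> B \<in> I)))"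

definition homogeneous_ideal :: "'a set \<Rightarrow> 'a set set \<Rightarrow> bool" where
  "homogeneous_ideal X I \<longleftrightarrow>
     (\<forall>A \<in> positive_sets X I. ideal_isomorphic A (ideal_restrict I A) X I)"

definition katetov_homogeneous_ideal :: "'a set \<Rightarrow> 'a set set \<Rightarrow> bool" where
  "katetov_homogeneous_ideal X I \<longleftrightarrow>
     (\<forall>A \<in> positive_sets X I.
        katetov_le A (ideal_restrict I A) X I \<and> katetov_le X I A (ideal_restrict I A))"

text \<open>As for \<^const>\<open>clique\<close> and \<^const>\<open>indep\<close>, a graph is given by its set of edges. Requiring
  edges to be two-element sets makes it simple.\<close>

definition random_graph :: "nat set set \<Rightarrow> bool" where
  "random_graph E \<longleftrightarrow>
     E \<subseteq> [UNIV]\<^bsup>2\<^esup> \<and>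
     (\<forall>U V. finite U \<and> finite V \<and> U \<inter> V = {} \<longrightarrow>
        (\<exists>x. x \<notin> U \<union> V \<and> (\<forall>u\<in>U. {x, u} \<in> E) \<and> (\<forall>v\<in>V. {x, v} \<notin> E)))"

definition homogeneous_set :: "'a set set \<Rightarrow> 'a set \<Rightarrow> bool" where
  "homogeneous_set E H \<longleftrightarrow> clique H E \<or> indep H E"

definition homogeneous_sets_ideal :: "'a set set \<Rightarrow> 'a set set" where
  "homogeneous_sets_ideal E =
     {A. \<exists>\<H>. finite \<H> \<and> (\<forall>H\<in>\<H>. homogeneous_set E H) \<and> A \<subseteq> \<Union>\<H>}"

end

theory Submission
  imports Defs
begin

text \<open>Write \<open>\<R>\<close> for the ideal. A vertex type over a finite set of vertices is never covered by
  finitely many homogeneous sets, so along any partition of the vertices into members of \<open>\<R>\<close>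
  one can greedily choose a selector inducing any prescribed countable graph. Let \<open>A\<close> induce an
  infinite disjoint union of infinite cliques; then \<open>A \<notin> \<R>\<close>. If \<open>f\<close> witnessed
  \<open>\<R> \<restriction> A \<le>\<^sub>K \<R>\<close>, the preimages of the cliques would partition the vertices into members
  of \<open>\<R>\<close>. Take a selector \<open>B\<close> again inducing a disjoint union of infinitely many infinite cliques.
  Its image \<open>f[B]\<close> meets each clique of \<open>A\<close> in at most one point, so it is independent, and
  \<open>B \<subseteq> f\<^sup>-\<^sup>1[f[B]]\<close> would lie in \<open>\<R>\<close>, a contradiction.\<close>

text \<open>Induction on the family, for all \<open>U\<close> and \<open>V\<close> at once. If the
  vertex \<open>y\<close> obtained for the smaller family falls into the new set \<open>H\<close>,
  realise the type extended by \<open>y\<close>: put \<open>y\<close> into \<open>V\<close> if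
  \<open>H\<close> is a clique, into \<open>U\<close> if \<open>H\<close> is independent. The
  resulting vertex has the wrong adjacency to \<open>y\<close> to belong to
  \<open>H\<close>.\<close>

lemma random_graph_type_not_covered:
  assumes "random_graph E" "finite \<H>" "\<forall>H\<in>\<H>. homogeneous_set E H"
    and "finite U" "finite V" "U \<inter> V = {}"
  shows "\<exists>x. x \<notin> U \<union> V \<and> (\<forall>u\<in>U. {x, u} \<in> E) \<and> (\<forall>v\<in>V. {x, v} \<notin> E) \<and> x \<notin> \<Union>\<H>"
  using assms(2-)
proof (induction \<H> arbitrary: U V rule: finite_induct)
  case empty
  then show ?case
    using assms(1) unfolding random_graph_def by auto
next
  case (insert H \<H>)
  obtain y where y: "y \<notin> U \<union> V" "\<forall>u\<in>U. {y, u} \<in> E" "\<forall>v\<in>V. {y, v} \<notin> E" "y \<notin> \<Union>\<H>"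
    using insert.IH[of U V] insert.prems by auto
  show ?case
  proof (cases "y \<in> H")
    case False
    with y show ?thesis by (intro exI[of _ y]) auto
  next
    case True
    consider "clique H E" | "indep H E"
      using insert.prems(1) by (auto simp: homogeneous_set_def)
    then show ?thesis
    proof cases
      case 1
      obtain x where x: "x \<notin> U \<union> insert y V" "\<forall>u\<in>U. {x, u} \<in> E"
        "\<forall>v\<in>insert y V. {x, v} \<notin> E" "x \<notin> \<Union>\<H>"
        using insert.IH[of U "insert y V"] insert.prems y(1) by auto
      moreover have "x \<notin> H"
        using 1 True x by (auto simp: clique_def)
      ultimately show ?thesis by (intro exI[of _ x]) auto
    next
      case 2
      obtain x where x: "x \<notin> insert y U \<union> V" "\<forall>u\<in>insert y U. {x, u} \<in> E"
        "\<forall>v\<in>V. {x, v} \<notin> E" "x \<notin> \<Union>\<H>"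
        using insert.IH[of "insert y U" V] insert.prems y(1) by auto
      moreover have "x \<notin> H"
        using 2 True x by (auto simp: indep_def)
      ultimately show ?thesis by (intro exI[of _ x]) auto
    qed
  qed
qed

lemma homogeneous_sets_ideal_mono:
  "A \<in> homogeneous_sets_ideal E \<Longrightarrow> B \<subseteq> A \<Longrightarrow> B \<in> homogeneous_sets_ideal E"
  unfolding homogeneous_sets_ideal_def mem_Collect_eq by (meson order_trans)

lemma homogeneous_set_in_ideal: "homogeneous_set E H \<Longrightarrow> H \<in> homogeneous_sets_ideal E"
  unfolding homogeneous_sets_ideal_def by (intro CollectI exI[of _ "{H}"]) auto

lemma homogeneous_sets_ideal_UN:
  assumes "finite I" "\<And>i. i \<in> I \<Longrightarrow> A i \<in> homogeneous_sets_ideal E"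
  shows "(\<Union>i\<in>I. A i) \<in> homogeneous_sets_ideal E"
proof -
  have "\<exists>\<H>. finite \<H> \<and> (\<forall>H\<in>\<H>. homogeneous_set E H) \<and> A i \<subseteq> \<Union>\<H>" if "i \<in> I" for i
    using assms(2)[OF that] by (simp add: homogeneous_sets_ideal_def)
  then obtain \<H> where \<H>: "\<And>i. i \<in> I \<Longrightarrow> finite (\<H> i)"
    "\<And>i. i \<in> I \<Longrightarrow> \<forall>H\<in>\<H> i. homogeneous_set E H" "\<And>i. i \<in> I \<Longrightarrow> A i \<subseteq> \<Union>(\<H> i)"
    by metis
  show ?thesis
    unfolding homogeneous_sets_ideal_def
  proof (intro CollectI exI conjI)
    show "finite (\<Union>i\<in>I. \<H> i)"
      using assms(1) \<H>(1) by simp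
    show "\<forall>H\<in>(\<Union>i\<in>I. \<H> i). homogeneous_set E H"
      using \<H>(2) by auto
    show "(\<Union>i\<in>I. A i) \<subseteq> \<Union>(\<Union>i\<in>I. \<H> i)"
    proof (rule UN_least)
      fix i
      assume "i \<in> I"
      then have "\<Union>(\<H> i) \<subseteq> \<Union>(\<Union>i\<in>I. \<H> i)" by (intro Union_mono UN_upper)
      with \<H>(3)[OF \<open>i \<in> I\<close>] show "A i \<subseteq> \<Union>(\<Union>i\<in>I. \<H> i)" by (rule order_trans)
    qed
  qed
qed

lemma finite_in_homogeneous_sets_ideal:
  assumes "finite F"
  shows "F \<in> homogeneous_sets_ideal E"
proof -
  have "{x} \<in> homogeneous_sets_ideal E" for x
    by (intro homogeneous_set_in_ideal) (simp add: homogeneous_set_def clique_def)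
  with homogeneous_sets_ideal_UN[OF assms, of "\<lambda>x. {x}"] show ?thesis by simp
qed

lemma is_ideal_homogeneous_sets_ideal:
  assumes "random_graph E"
  shows "is_ideal UNIV (homogeneous_sets_ideal E)"
proof -
  have "A \<union> B \<in> homogeneous_sets_ideal E"
    if "A \<in> homogeneous_sets_ideal E" "B \<in> homogeneous_sets_ideal E" for A B
    using homogeneous_sets_ideal_UN[of "{A, B}" "\<lambda>X. X" E] that by auto
  \<comment> \<open>The empty type already yields a vertex outside any given finite family of
    homogeneous sets.\<close>
  moreover have "UNIV \<notin> homogeneous_sets_ideal E"
    using random_graph_type_not_covered[OF assms, of _ "{}" "{}"]
    by (fastforce simp: homogeneous_sets_ideal_def)
  ultimately show ?thesis
    unfolding is_ideal_def
    by (auto intro: homogeneous_sets_ideal_mono finite_in_homogeneous_sets_ideal)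
qed

text \<open>The fibres of \<open>g\<close> are the pieces of the partition. At each stage only
  finitely many fibres have been met; their union is in the ideal, so the next required type is
  realised outside it.\<close>

lemma random_graph_selector:
  fixes P :: "nat \<Rightarrow> nat \<Rightarrow> bool" and g :: "nat \<Rightarrow> 'b"
  assumes E: "random_graph E"
    and g: "\<And>n. {x. g x = n} \<in> homogeneous_sets_ideal E"
    and P: "\<And>i j. P i j \<longleftrightarrow> P j i"
  obtains e where "inj (g \<circ> e)" "\<And>i j. i \<noteq> j \<Longrightarrow> {e i, e j} \<in> E \<longleftrightarrow> P i j"
proof -
  \<comment> \<open>\<open>Q e n x\<close> consults \<open>e\<close> only below \<open>n\<close>, so
    values can be chosen by well-founded recursion.\<close>
  define Q where
    "Q e n x \<longleftrightarrow> (\<forall>i<n. g x \<noteq> g (e i) \<and> ({x, e i} \<in> E \<longleftrightarrow> P n i))" for e n x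
  have "\<exists>e. \<forall>n. Q e n (e n)"
  proof (rule dependent_wellorder_choice)
    fix x :: nat and r and e e' :: "nat \<Rightarrow> nat"
    assume "\<And>y. y < x \<Longrightarrow> e y = e' y"
    then show "Q e x r = Q e' x r" unfolding Q_def by auto
  next
    fix n e
    assume prev: "\<And>m. m < n \<Longrightarrow> Q e m (e m)"
    define U where "U = e ` {i. i < n \<and> P n i}"
    define V where "V = e ` {i. i < n \<and> \<not> P n i}"
    \<comment> \<open>Earlier values lie in different fibres of \<open>g\<close>, hence are
      distinct; so the index sets defining \<open>U\<close> and \<open>V\<close> have disjoint
      images.\<close>
    have "inj_on e {..<n}"
      by (rule linorder_inj_onI) (use prev in \<open>force simp: Q_def\<close>)+
    then have "U \<inter> V = {}"
      by (auto simp: U_def V_def inj_on_def)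
    moreover have "(\<Union>i<n. {x. g x = g (e i)}) \<in> homogeneous_sets_ideal E"
      by (rule homogeneous_sets_ideal_UN) (use g in auto)
    then obtain \<H> where \<H>: "finite \<H>" "\<forall>H\<in>\<H>. homogeneous_set E H"
      "(\<Union>i<n. {x. g x = g (e i)}) \<subseteq> \<Union>\<H>"
      by (auto simp: homogeneous_sets_ideal_def)
    ultimately obtain x where "\<forall>u\<in>U. {x, u} \<in> E" "\<forall>v\<in>V. {x, v} \<notin> E" "x \<notin> \<Union>\<H>"
      using random_graph_type_not_covered[OF E \<H>(1,2), of U V] by (auto simp: U_def V_def)
    with \<H>(3) have "Q e n x" unfolding Q_def U_def V_def by blast
    then show "\<exists>x. Q e n x" ..
  qed
  then obtain e where e: "\<And>n. Q e n (e n)" by blast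
  have "inj (g \<circ> e)"
    by (rule linorder_inj_onI) (use e in \<open>force simp: Q_def\<close>)+
  \<comment> \<open>\<open>Q\<close> decides an edge only at the larger index; symmetry of
    \<open>P\<close> covers the other order.\<close>
  moreover have "{e i, e j} \<in> E \<longleftrightarrow> P i j" if "i \<noteq> j" for i j
    using that e[of i] e[of j] P[of i j] unfolding Q_def
    by (metis insert_commute nat_neq_iff)
  ultimately show ?thesis using that by blast
qed

text \<open>A clique meets at most one class of \<open>c\<close>, and an independent set meets each
  class in at most one point. So a finite homogeneous family has infinite trace on only finitely
  many classes, and it cannot cover any of the other classes, all of which are infinite.\<close>

lemma disjoint_cliques_not_in_ideal:
  fixes e :: "nat \<Rightarrow> 'a" and c :: "nat \<Rightarrow> nat"
  assumes e: "inj e" and E: "\<And>i j. i \<noteq> j \<Longrightarrow> {e i, e j} \<in> E \<longleftrightarrow> c i = c j"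
    and c: "\<And>k. infinite {i. c i = k}"
  shows "range e \<notin> homogeneous_sets_ideal E"
proof
  assume "range e \<in> homogeneous_sets_ideal E"
  then obtain \<H> where \<H>: "finite \<H>" "\<forall>H\<in>\<H>. homogeneous_set E H" "range e \<subseteq> \<Union>\<H>"
    by (auto simp: homogeneous_sets_ideal_def)
  define S where "S H k = {i. e i \<in> H \<and> c i = k}" for H k
  have "finite {k. infinite (S H k)}" if H: "H \<in> \<H>" for H
  proof -
    consider "clique H E" | "indep H E"
      using H \<H>(2) by (auto simp: homogeneous_set_def)
    then show ?thesis
    proof cases
      case 1
      have "c i = c j" if "e i \<in> H" "e j \<in> H" for i j
        using 1 that E[of i j] e by (cases "i = j") (auto simp: clique_def inj_eq)
      then have "\<exists>\<^sub>\<le>\<^sub>1k. k \<in> c ` {i. e i \<in> H}"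
        unfolding Uniq_def by blast
      then have "finite (c ` {i. e i \<in> H})"
        using subset_singleton_iff_Uniq finite_subset by (metis finite.emptyI finite_insert)
      moreover have "{k. infinite (S H k)} \<subseteq> c ` {i. e i \<in> H}"
        using not_finite_existsD by (fastforce simp: S_def)
      ultimately show ?thesis by (rule rev_finite_subset)
    next
      case 2
      have "i = j" if "i \<in> S H k" "j \<in> S H k" for i j k
        using 2 that E[of i j] e by (cases "i = j") (auto simp: S_def indep_def inj_eq)
      then have "\<exists>\<^sub>\<le>\<^sub>1i. i \<in> S H k" for k
        unfolding Uniq_def by blast
      then have "finite (S H k)" for k
        using subset_singleton_iff_Uniq finite_subset by (metis finite.emptyI finite_insert)
      then show ?thesis by simp
    qed
  qed
  then have "finite (\<Union>H\<in>\<H>. {k. infinite (S H k)})"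
    using \<H>(1) by blast
  then obtain k where "k \<notin> (\<Union>H\<in>\<H>. {k. infinite (S H k)})"
    using ex_new_if_finite infinite_UNIV_nat by blast
  then have "finite (\<Union>H\<in>\<H>. S H k)" using \<H>(1) by auto
  moreover have "{i. c i = k} \<subseteq> (\<Union>H\<in>\<H>. S H k)"
    using \<H>(3) by (auto simp: S_def)
  ultimately show False using c finite_subset by blast
qed

lemma ideal_isomorphic_imp_katetov_le:
  assumes "I \<subseteq> Pow X" "ideal_isomorphic X I Y K"
  shows "katetov_le X I Y K"
proof -
  obtain f where "bij_betw f Y X" "\<forall>B. B \<subseteq> X \<longrightarrow> (f -` B \<inter> Y \<in> K \<longleftrightarrow> B \<in> I)"
    using assms(2) by (auto simp: ideal_isomorphic_def)
  with assms(1) have "f \<in> Y \<rightarrow> X" "\<forall>B\<in>I. f -` B \<inter> Y \<in> K"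
    by (auto simp: bij_betw_imp_funcset)
  then show ?thesis by (auto simp: katetov_le_def)
qed

theorem proposition10p4:
  fixes E :: "nat set set"
  assumes "random_graph E"
  shows "is_ideal UNIV (homogeneous_sets_ideal E) \<and>
    \<not> katetov_homogeneous_ideal UNIV (homogeneous_sets_ideal E) \<and>
    \<not> homogeneous_ideal UNIV (homogeneous_sets_ideal E)"
proof -
  let ?R = "homogeneous_sets_ideal E"
  \<comment> \<open>Colouring by the first coordinate of the pairing splits the indices into
    infinitely many infinite classes.\<close>
  define c where "c i = fst (prod_decode i)" for i
  have c: "infinite {i. c i = k}" for k
  proof -
    have "inj (\<lambda>j. prod_encode (k, j))" by (auto simp: inj_def)
    moreover have "range (\<lambda>j. prod_encode (k, j)) \<subseteq> {i. c i = k}" by (auto simp: c_def)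
    ultimately show ?thesis
      using range_inj_infinite infinite_super by blast
  qed
  have selector: "\<exists>e. inj (g \<circ> e) \<and> (\<forall>i j. i \<noteq> j \<longrightarrow> {e i, e j} \<in> E \<longleftrightarrow> c i = c j)"
    if "\<And>n. {x. g x = n} \<in> ?R" for g :: "nat \<Rightarrow> nat"
    using random_graph_selector[OF assms that, of "\<lambda>i j. c i = c j"] by metis
  \<comment> \<open>For \<open>id\<close> the fibres are singletons, so the selector is just an
    embedded copy of the prescribed graph.\<close>
  obtain a where a: "inj a" "\<And>i j. i \<noteq> j \<Longrightarrow> {a i, a j} \<in> E \<longleftrightarrow> c i = c j"
    using selector[of id] by (auto simp: finite_in_homogeneous_sets_ideal)
  define A where "A = range a"
  have A: "A \<in> positive_sets UNIV ?R"
    using disjoint_cliques_not_in_ideal[OF a c] by (simp add: positive_sets_def A_def)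
  have not_le: "\<not> katetov_le A (ideal_restrict ?R A) UNIV ?R"
  proof
    assume "katetov_le A (ideal_restrict ?R A) UNIV ?R"
    then obtain f where f: "f \<in> UNIV \<rightarrow> A" "\<And>B. B \<in> ideal_restrict ?R A \<Longrightarrow> f -` B \<in> ?R"
      by (auto simp: katetov_le_def)
    have vimage: "f -` H \<in> ?R" if "homogeneous_set E H" "H \<subseteq> A" for H
      using f(2)[of H] homogeneous_set_in_ideal[OF that(1)] that(2)
      by (auto simp: ideal_restrict_def)
    \<comment> \<open>\<open>h x\<close> is the index of \<open>f x\<close> in \<open>A\<close>, so
      \<open>c (h x)\<close> names the clique of \<open>A\<close> containing \<open>f x\<close>, and
      its fibres are the preimages of these cliques.\<close>
    define h where "h x = inv a (f x)" for x
    have h: "f x = a (h x)" for x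
      using f(1) by (auto simp: h_def A_def f_inv_into_f Pi_def)
    have "{x. c (h x) = n} \<in> ?R" for n
    proof -
      have "{a i, a j} \<in> E" if "c i = n" "c j = n" "a i \<noteq> a j" for i j
        using a(2)[of i j] that by auto
      then have "homogeneous_set E (a ` {i. c i = n})"
        by (auto simp: homogeneous_set_def clique_def)
      from vimage[OF this] have "f -` a ` {i. c i = n} \<in> ?R" by (auto simp: A_def)
      moreover have "{x. c (h x) = n} \<subseteq> f -` a ` {i. c i = n}" by (auto simp: h)
      ultimately show ?thesis by (rule homogeneous_sets_ideal_mono)
    qed
    then obtain b where b: "inj ((\<lambda>x. c (h x)) \<circ> b)" "\<And>i j. i \<noteq> j \<Longrightarrow> {b i, b j} \<in> E \<longleftrightarrow> c i = c j"
      using selector[of "\<lambda>x. c (h x)"] by auto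
    \<comment> \<open>Distinct points of \<open>range b\<close> have different values of
      \<open>c (h x)\<close>, so \<open>f\<close> sends them to different cliques of
      \<open>A\<close>.\<close>
    have "indep (f ` range b) E"
      unfolding indep_def
    proof (intro ballI impI)
      fix v w
      assume "v \<in> f ` range b" "w \<in> f ` range b" and "v \<noteq> w"
      then obtain i j where "v = a (h (b i))" "w = a (h (b j))" "i \<noteq> j"
        using h by auto
      moreover from this have "c (h (b i)) \<noteq> c (h (b j))"
        using b(1) by (auto simp: inj_def)
      ultimately show "{v, w} \<notin> E"
        using a(2) by metis
    qed
    then have "f -` f ` range b \<in> ?R"
      using f(1) by (intro vimage) (auto simp: homogeneous_set_def)
    then have "range b \<in> ?R"
      by (rule homogeneous_sets_ideal_mono) auto
    moreover have "inj b" using b(1) by (rule inj_on_imageI2)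
    ultimately show False
      using disjoint_cliques_not_in_ideal[OF _ b(2) c] by blast
  qed
  \<comment> \<open>The bijection of an isomorphism would itself witness the Katetov reduction just
    refuted.\<close>
  then have "\<not> ideal_isomorphic A (ideal_restrict ?R A) UNIV ?R"
    using ideal_isomorphic_imp_katetov_le[of "ideal_restrict ?R A" A]
    by (auto simp: ideal_restrict_def)
  with not_le A show ?thesis
    using is_ideal_homogeneous_sets_ideal[OF assms]
    by (auto simp: katetov_homogeneous_ideal_def homogeneous_ideal_def)
qed

end
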